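(* Let $r\in(0,\infty)$, $v=1/(1+1/r)$ and $\lambda>0$. Let $\hat p$ be the univariate Bayesian predictive density under the Laplace prior $\pi_1(\mu\mid\lambda)=\frac{\lambda}{2}e^{-\lambda|\mu|}$ on $\mathbb{R}$, and let $\rho(\theta,\hat p)$ be its Kullback-Leibler prediction risk at $\theta\in\mathbb{R}$. Then $$\rho(0,\hat p)\le \log\left(1+\frac{\sqrt2}{\lambda\sqrt{\pi v}}\right)+\frac{4}{\lambda^2 v}$$ and $$\sup_{\theta\ne0}\rho(\theta,\hat p)\le \log\left(\sqrt{\frac{32\lambda^2\pi}{v}}\right)+\frac{\lambda^2}{2}+\lambda\sqrt{\frac{2}{\pi}}+\frac{4}{\lambda^2}.$$
   Context: Univariate prediction problem: given $\theta\in\mathbb{R}$, $Y\sim N(\theta,1)$ is observed and the independent $\tilde Y\sim N(\theta,r)$ is to be predicted, with $r\in(0,\infty)$ known. Write $\pi(Y\mid\theta)$ and $\pi(\tilde Y\mid\theta)$ for the $N(\theta,1)$ and $N(\theta,r)$ densities. For a prior $\pi_1$ on $\mathbb{R}$, the Bayesian predictive density is $$\hat p(\tilde Y\mid Y)=\frac{\int\pi(\tilde Y\mid\mu)\pi(Y\mid\mu)\pi_1(\mu)\,d\mu}{\int\pi(Y\mid\mu)\pi_1(\mu)\,d\mu},$$ and its risk is $$\rho(\theta,\hat p)=\int\pi(Y\mid\theta)\int\pi(\tilde Y\mid\theta)\log\frac{\pi(\tilde Y\mid\theta)}{\hat p(\tilde Y\mid Y)}\,d\tilde Y\,dY.$$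 *)

theory Defs
  imports "HOL-Probability.Probability"
begin

text \<open>
  In \<^const>\<open>normal_density\<close> the second argument is the standard deviation, so that
  N(t, r), with \<^term>\<open>r\<close> the variance, has density \<^term>\<open>normal_density t (sqrt r)\<close>.
  Priors are given by their densities with respect to Lebesgue measure.
\<close>

definition laplace_density :: "real \<Rightarrow> real \<Rightarrow> real" where
  "laplace_density l \<mu> = l / 2 * exp (- l * \<bar>\<mu>\<bar>)"

definition bayes_predictive_density :: "real \<Rightarrow> (real \<Rightarrow> real) \<Rightarrow> real \<Rightarrow> real \<Rightarrow> real" where
  "bayes_predictive_density r prior y z =
     (\<integral>\<mu>. normal_density \<mu> (sqrt r) z * normal_density \<mu> 1 y * prior \<mu> \<partial>lborel) /
     (\<integral>\<mu>. normal_density \<mu> 1 y * prior \<mu> \<partial>lborel)"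

text \<open>
  Predictive densities \<^term>\<open>p\<close> are curried: \<^term>\<open>p y z\<close> is the density at the future value
  \<^term>\<open>z\<close> given the observation \<^term>\<open>y\<close>.
\<close>

definition prediction_loss :: "real \<Rightarrow> real \<Rightarrow> (real \<Rightarrow> real \<Rightarrow> real) \<Rightarrow> real \<Rightarrow> real" where
  "prediction_loss r \<theta> p y =
     (\<integral>z. normal_density \<theta> (sqrt r) z * ln (normal_density \<theta> (sqrt r) z / p y z) \<partial>lborel)"

definition prediction_risk :: "real \<Rightarrow> real \<Rightarrow> (real \<Rightarrow> real \<Rightarrow> real) \<Rightarrow> real" where
  "prediction_risk r \<theta> p = (\<integral>y. normal_density \<theta> 1 y * prediction_loss r \<theta> p y \<partial>lborel)"

text \<open>
  The Bochner integral of a non-integrable function is 0. The next predicate says that both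
  integrals in the risk converge, so that the value of \<^const>\<open>prediction_risk\<close> is genuine.
\<close>

definition prediction_risk_converges :: "real \<Rightarrow> real \<Rightarrow> (real \<Rightarrow> real \<Rightarrow> real) \<Rightarrow> bool" where
  "prediction_risk_converges r \<theta> p \<longleftrightarrow>
     (\<forall>y. integrable lborel
        (\<lambda>z. normal_density \<theta> (sqrt r) z * ln (normal_density \<theta> (sqrt r) z / p y z))) \<and>
     integrable lborel (\<lambda>y. normal_density \<theta> 1 y * prediction_loss r \<theta> p y)"

end

theory Submission
  imports Defs
begin

text \<open>
  Let \<open>Y \<sim> N(\<theta>, 1)\<close> and \<open>Z \<sim> N(\<theta>, r)\<close> be independent, and let \<open>v = r / (1 + r)\<close>, which is the
  \<open>v\<close> of the theorem.
  The weighted mean \<open>W = (r Y + Z) / (1 + r) \<sim> N(\<theta>, v)\<close> is sufficient for \<open>\<theta>\<close> in the pair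
  \<open>(Y, Z)\<close>. Hence, for any prior, the log-ratio in the loss is the log-likelihood ratio of \<open>N(\<theta>, v)\<close>
  against the marginal law at \<open>W\<close>, minus the same quantity for variance \<open>1\<close> at \<open>Y\<close>
  (\<open>ln_ratio_predictive\<close>). Averaging shows
  that the risk at \<open>\<theta>\<close> is \<open>D\<^sub>\<theta>(v) - D\<^sub>\<theta>(1)\<close>, where \<open>D\<^sub>\<theta>(t)\<close> is the Kullback-Leibler
  divergence from \<open>N(\<theta>, t)\<close> to the marginal distribution of an observation of variance \<open>t\<close>
  (\<open>prediction_risk_eq_marginal_kl_diff\<close>). All integrals converge as soon as the logarithms of the
  marginals grow at most quadratically.

  At \<open>\<theta> = 0\<close> the divergence \<open>D\<^sub>0(1)\<close> is nonnegative. For \<open>D\<^sub>0(v)\<close>, Jensen's inequality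
  with respect to the prior shows that the marginal is at least \<open>exp (- 1 / (l\<^sup>2 v))\<close> times the
  \<open>N(0, v)\<close> density (\<open>laplace_marginal_ge_centred_normal\<close>). So the risk is at most \<open>1 / (l\<^sup>2 v)\<close>.

  For the bound on the supremum, the logarithm of the marginal at variance \<open>s\<^sup>2\<close> is
  \<open>ln (l / 2) - l \<bar>x\<bar>\<close> up to an error between \<open>- l s sqrt (2 / \<pi>)\<close>, again by Jensen
  (\<open>laplace_marginal_ge\<close>), and \<open>l\<^sup>2 s\<^sup>2 / 2\<close>, by the normal moment generating function
  (\<open>laplace_marginal_le\<close>). In the difference of the divergences the terms \<open>l \<bar>x\<bar>\<close> contribute
  \<open>l (E \<bar>W\<bar> - E \<bar>Y\<bar>) \<le> 0\<close>, by convexity and \<open>v \<le> 1\<close> (\<open>normal_abs_mean_mono\<close>), and the normal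
  entropies contribute \<open>- ln (sqrt v)\<close>. The risk is thus at most
  \<open>- ln (sqrt v) + l\<^sup>2 / 2 + l sqrt (2 / \<pi>)\<close>, and the terms of the claim that remain,
  \<open>ln (sqrt (32 l\<^sup>2 \<pi>)) + 4 / l\<^sup>2\<close>, have a nonnegative sum (\<open>log_slack_nonneg\<close>).
\<close>

section \<open>Sufficiency of the weighted mean\<close>

text \<open>
  Completing the square in \<open>\<mu>\<close>. For independent \<open>Y \<sim> N(\<mu>, 1)\<close> and \<open>Z \<sim> N(\<mu>, r)\<close> the
  weighted mean \<open>W = (r Y + Z) / (1 + r)\<close> is sufficient for \<open>\<mu>\<close>, and the joint density
  splits into the \<open>N(\<mu>, r / (1 + r))\<close> density at \<open>W\<close> and a factor free of \<open>\<mu>\<close>.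
\<close>
lemma normal_density_product:
  fixes r y z \<mu> :: real
  assumes r: "r > 0"
  shows "normal_density \<mu> (sqrt r) z * normal_density \<mu> 1 y =
    normal_density y (sqrt (1 + r)) z * normal_density \<mu> (sqrt (r / (1 + r))) ((r * y + z) / (1 + r))"
proof -
  have const: "sqrt (2 * pi * r) * sqrt (2 * pi) = sqrt (2 * pi * (1 + r)) * sqrt (2 * pi * (r / (1 + r)))"
    using r by (simp add: real_sqrt_mult[symmetric])
  have square: "(r * y + z) / (1 + r) - \<mu> = (r * (y - \<mu>) + (z - \<mu>)) / (1 + r)"
    using r by (simp add: field_simps)
  have diff: "z - y = (z - \<mu>) - (y - \<mu>)" by simp
  have ident: "a\<^sup>2 / (2 * r) + b\<^sup>2 / 2 =
      (a - b)\<^sup>2 / (2 * (1 + r)) + ((r * b + a) / (1 + r))\<^sup>2 / (2 * (r / (1 + r)))" for a b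
  proof -
    have "((r * b + a) / (1 + r))\<^sup>2 / (2 * (r / (1 + r))) = (r * b + a)\<^sup>2 / (2 * r * (1 + r))"
      using r by (simp add: power_divide power2_eq_square)
    moreover have "a\<^sup>2 / (2 * r) + b\<^sup>2 / 2 = (a\<^sup>2 + r * b\<^sup>2) * (1 + r) / (2 * r * (1 + r))"
      using r by (simp add: add_divide_distrib)
    moreover have "(a - b)\<^sup>2 / (2 * (1 + r)) = r * (a - b)\<^sup>2 / (2 * r * (1 + r))"
      using r by simp
    moreover have "(a\<^sup>2 + r * b\<^sup>2) * (1 + r) = r * (a - b)\<^sup>2 + (r * b + a)\<^sup>2"
      by (simp add: power2_eq_square algebra_simps)
    ultimately show ?thesis by (simp add: add_divide_distrib)
  qed
  have "exp (- (z - \<mu>)\<^sup>2 / (2 * r)) * exp (- (y - \<mu>)\<^sup>2 / 2) =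
    exp (- (z - y)\<^sup>2 / (2 * (1 + r))) *
    exp (- ((r * y + z) / (1 + r) - \<mu>)\<^sup>2 / (2 * (r / (1 + r))))"
    using ident[of "z - \<mu>" "y - \<mu>"] unfolding exp_add[symmetric] square diff by simp
  then show ?thesis
    using r const unfolding normal_density_def
    by (simp add: real_sqrt_pow2 divide_simps)
qed

definition marginal_density :: "(real \<Rightarrow> real) \<Rightarrow> real \<Rightarrow> real \<Rightarrow> real" where
  "marginal_density prior s x = (\<integral>\<mu>. normal_density \<mu> s x * prior \<mu> \<partial>lborel)"

text \<open>
  The factor free of \<open>\<mu>\<close> leaves the integral in the numerator, and what remains is the marginal
  density of \<open>W\<close>.
\<close>
lemma bayes_predictive_density_eq:
  assumes r: "r > 0"
  shows "bayes_predictive_density r prior y z = normal_density y (sqrt (1 + r)) z *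
    marginal_density prior (sqrt (r / (1 + r))) ((r * y + z) / (1 + r)) / marginal_density prior 1 y"
  unfolding bayes_predictive_density_def marginal_density_def normal_density_product[OF r]
  by (simp add: mult.assoc)

definition log_likelihood_ratio :: "(real \<Rightarrow> real) \<Rightarrow> real \<Rightarrow> real \<Rightarrow> real \<Rightarrow> real" where
  "log_likelihood_ratio prior \<theta> s x = ln (normal_density \<theta> s x / marginal_density prior s x)"

text \<open>
  The Kullback-Leibler divergence from \<open>N(\<theta>, s\<^sup>2)\<close> to the marginal distribution of an observation
  with variance \<open>s\<^sup>2\<close>, when that marginal is positive and the integral converges.
\<close>
definition marginal_kl :: "(real \<Rightarrow> real) \<Rightarrow> real \<Rightarrow> real \<Rightarrow> real" where
  "marginal_kl prior \<theta> s = (\<integral>x. normal_density \<theta> s x * log_likelihood_ratio prior \<theta> s x \<partial>lborel)"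

text \<open>
  The true joint density of \<open>(Y, Z)\<close> has the same factor free of the mean as the mixture in the
  numerator. It cancels, and the pointwise loss becomes the loss for \<open>W\<close> minus the loss for \<open>Y\<close>.
\<close>
lemma ln_ratio_predictive:
  assumes r: "r > 0"
    and pos: "\<And>s x. s > 0 \<Longrightarrow> marginal_density prior s x > 0"
  shows "ln (normal_density \<theta> (sqrt r) z / bayes_predictive_density r prior y z) =
    log_likelihood_ratio prior \<theta> (sqrt (r / (1 + r))) ((r * y + z) / (1 + r)) -
    log_likelihood_ratio prior \<theta> 1 y"
proof -
  define s where "s = sqrt (r / (1 + r))"
  define w where "w = (r * y + z) / (1 + r)"
  have s: "s > 0" using r by (simp add: s_def)
  have pos1: "normal_density \<theta> 1 y > 0" "normal_density \<theta> s w > 0" 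
    "normal_density y (sqrt (1 + r)) z > 0" "normal_density \<theta> (sqrt r) z > 0"
    using r s by (auto intro!: normal_density_pos)
  have m: "marginal_density prior s w > 0" "marginal_density prior 1 y > 0"
    using pos s by auto
  have "normal_density \<theta> (sqrt r) z = normal_density y (sqrt (1 + r)) z * normal_density \<theta> s w / normal_density \<theta> 1 y"
    using normal_density_product[OF r, of \<theta> z y] pos1 unfolding s_def w_def by (simp add: field_simps)
  then have "normal_density \<theta> (sqrt r) z / bayes_predictive_density r prior y z =
    (normal_density \<theta> s w / marginal_density prior s w) / (normal_density \<theta> 1 y / marginal_density prior 1 y)"
    unfolding bayes_predictive_density_eq[OF r] s_def[symmetric] w_def[symmetric]
    using pos1 m by (simp add: field_simps)
  then show ?thesis
    unfolding log_likelihood_ratio_def s_def[symmetric] w_def[symmetric]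
    using pos1 m by (simp add: ln_div ln_mult)
qed

text \<open>
  If \<open>Y \<sim> N(\<theta>, 1)\<close> and \<open>Z \<sim> N(\<theta>, r)\<close> are independent, then \<open>(r Y + Z) / (1 + r)\<close> has law
  \<open>N(\<theta>, r / (1 + r))\<close>. The claim is stated for iterated integrals because the risk is one. For fixed
  \<open>y\<close> the variable \<open>z\<close> is replaced by \<open>x = w(y, z)\<close>; the integrand then becomes the density of
  \<open>W\<close> at \<open>x\<close> times the conditional density \<open>N(x, 1 / (1 + r))\<close> of \<open>Y\<close> given \<open>W = x\<close>, and
  integrating out \<open>y\<close> first gives the result.
\<close>
lemma normal_average_of_combination:
  fixes g :: "real \<Rightarrow> real"
  assumes r: "r > 0" and g: "integrable lborel (\<lambda>x. normal_density \<theta> (sqrt (r / (1 + r))) x * g x)"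
    and [measurable]: "g \<in> borel_measurable borel"
  shows "(\<integral>y. normal_density \<theta> 1 y * (\<integral>z. normal_density \<theta> (sqrt r) z * g ((r * y + z) / (1 + r)) \<partial>lborel) \<partial>lborel)
    = (\<integral>x. normal_density \<theta> (sqrt (r / (1 + r))) x * g x \<partial>lborel)"
proof -
  define s where "s = sqrt (r / (1 + r))"
  define t where "t = 1 / sqrt (1 + r)"
  define F where "F = (\<lambda>(x, y). normal_density \<theta> s x * g x * normal_density x t y)"
  have t: "t > 0" using r by (simp add: t_def)
  have nd_meas: "(\<lambda>(x, y). normal_density x t y) \<in> borel_measurable (lborel \<Otimes>\<^sub>M lborel)"
    unfolding normal_density_def by measurable
  have Fm [measurable]: "F \<in> borel_measurable (lborel \<Otimes>\<^sub>M lborel)"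
    using nd_meas unfolding F_def by measurable
  have nF: "norm (F (x, y)) = \<bar>normal_density \<theta> s x * g x\<bar> * normal_density x t y" for x y
    by (simp add: F_def abs_mult)
  have F_int: "integrable (lborel \<Otimes>\<^sub>M lborel) F"
  proof (rule lborel_pair.Fubini_integrable[OF Fm])
    show "integrable lborel (\<lambda>x. \<integral>y. norm (F (x, y)) \<partial>lborel)"
      unfolding nF using g t by (simp add: s_def integral_normal_density)
    show "AE x in lborel. integrable lborel (\<lambda>y. F (x, y))"
      unfolding F_def using t by simp
  qed
  have cov: "normal_density \<theta> 1 y * (\<integral>z. normal_density \<theta> (sqrt r) z * g ((r * y + z) / (1 + r)) \<partial>lborel)
      = (\<integral>x. F (x, y) \<partial>lborel)" for y
  proof -
    have w: "(r * y + (- r * y + (1 + r) * x)) / (1 + r) = x" for x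
      using r by (simp add: field_simps)
    have pw: "(1 + r) * (normal_density \<theta> 1 y * normal_density \<theta> (sqrt r) (- r * y + (1 + r) * x)) =
        normal_density \<theta> s x * normal_density x t y" for x
    proof -
      have d: "- r * y + (1 + r) * x - y = (1 + r) * (x - y)" by (simp add: algebra_simps)
      have sq: "sqrt (2 * pi * (1 + r)) = (1 + r) * sqrt (2 * pi / (1 + r))"
      proof -
        have "2 * pi * (1 + r) = (1 + r)\<^sup>2 * (2 * pi / (1 + r))"
          using r by (simp add: power2_eq_square)
        then show ?thesis
          using r by (simp only: real_sqrt_mult real_sqrt_abs)
      qed
      have "k\<^sup>2 * c / (2 * k) = c * k / 2" if "k \<noteq> 0" for k c :: real
        using that by (simp add: power2_eq_square)
      from this[of "1 + r"] have cancel: "(1 + r)\<^sup>2 * c / (2 + 2 * r) = c * (1 + r) / 2" for c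
        using r by simp
      have "(1 + r) * normal_density y (sqrt (1 + r)) (- r * y + (1 + r) * x) = normal_density x t y"
        using r unfolding normal_density_def d t_def
        by (simp add: sq power_mult_distrib power2_commute[of x y] power_divide cancel)
      then show ?thesis
        using normal_density_product[OF r, of \<theta> "- r * y + (1 + r) * x" y]
        unfolding w s_def by (simp add: mult_ac)
    qed
    have "(\<integral>z. normal_density \<theta> (sqrt r) z * g ((r * y + z) / (1 + r)) \<partial>lborel) =
      (1 + r) * (\<integral>x. normal_density \<theta> (sqrt r) (- r * y + (1 + r) * x) *
        g ((r * y + (- r * y + (1 + r) * x)) / (1 + r)) \<partial>lborel)"
      using r lborel_integral_real_affine[of "1 + r" "\<lambda>z. normal_density \<theta> (sqrt r) z * g ((r * y + z) / (1 + r))" "- r * y"]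
      by simp
    also have "\<dots> = (1 + r) * (\<integral>x. normal_density \<theta> (sqrt r) (- r * y + (1 + r) * x) * g x \<partial>lborel)"
      unfolding w ..
    finally have "normal_density \<theta> 1 y * (\<integral>z. normal_density \<theta> (sqrt r) z * g ((r * y + z) / (1 + r)) \<partial>lborel)
      = (1 + r) * normal_density \<theta> 1 y * (\<integral>x. normal_density \<theta> (sqrt r) (- r * y + (1 + r) * x) * g x \<partial>lborel)"
      by simp
    also have "\<dots> = (\<integral>x. (1 + r) * normal_density \<theta> 1 y *
        (normal_density \<theta> (sqrt r) (- r * y + (1 + r) * x) * g x) \<partial>lborel)"
      by (rule integral_mult_right_zero[symmetric])
    also have "\<dots> = (\<integral>x. F (x, y) \<partial>lborel)"
    proof (intro Bochner_Integration.integral_cong refl)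
      show "(1 + r) * normal_density \<theta> 1 y * (normal_density \<theta> (sqrt r) (- r * y + (1 + r) * x) * g x) = F (x, y)" for x
        unfolding F_def using arg_cong[OF pw[of x], of "\<lambda>a. a * g x"] by (simp only: mult_ac prod.case)
    qed
    finally show ?thesis .
  qed
  have "(\<integral>y. normal_density \<theta> 1 y * (\<integral>z. normal_density \<theta> (sqrt r) z * g ((r * y + z) / (1 + r)) \<partial>lborel) \<partial>lborel)
    = (\<integral>y. \<integral>x. F (x, y) \<partial>lborel \<partial>lborel)"
    unfolding cov ..
  also have "\<dots> = (\<integral>x. \<integral>y. F (x, y) \<partial>lborel \<partial>lborel)"
    using lborel_pair.Fubini_integral[of "\<lambda>x y. F (x, y)"] F_int by simp
  also have "\<dots> = (\<integral>x. normal_density \<theta> s x * g x \<partial>lborel)"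
    unfolding F_def using t by simp
  finally show ?thesis unfolding s_def .
qed


section \<open>Integrability under quadratic growth\<close>

lemma square_le_shifted: "(x - c)\<^sup>2 \<le> 2 * x\<^sup>2 + 2 * c\<^sup>2" for x c :: real
proof -
  have "2 * x\<^sup>2 + 2 * c\<^sup>2 - (x - c)\<^sup>2 = (x + c)\<^sup>2"
    by (simp add: power2_eq_square algebra_simps)
  then show ?thesis using zero_le_power2[of "x + c"] by linarith
qed

lemma integrable_normal_quadratic:
  assumes s: "s > 0"
  shows "integrable lborel (\<lambda>x. normal_density \<theta> s x * (1 + x\<^sup>2))"
proof -
  have "integrable lborel (\<lambda>x. normal_density \<theta> s x * (x - \<theta>)^2 + 2 * \<theta> * (normal_density \<theta> s x * x)
      + (1 - \<theta>\<^sup>2) * normal_density \<theta> s x)"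
    using integrable_normal_moment[OF s, of \<theta> 2] integrable_normal_moment_nz_1[OF s, of \<theta>] s by simp
  moreover have "(\<lambda>x. normal_density \<theta> s x * (x - \<theta>)^2 + 2 * \<theta> * (normal_density \<theta> s x * x)
      + (1 - \<theta>\<^sup>2) * normal_density \<theta> s x) = (\<lambda>x. normal_density \<theta> s x * (1 + x\<^sup>2))"
    by (auto simp: power2_eq_square algebra_simps)
  ultimately show ?thesis by simp
qed

lemma integrable_normal_quadratic_growth:
  fixes g :: "real \<Rightarrow> real"
  assumes s: "s > 0" and [measurable]: "g \<in> borel_measurable borel"
    and bound: "\<And>x. \<bar>g x\<bar> \<le> C * (1 + x\<^sup>2)"
  shows "integrable lborel (\<lambda>x. normal_density \<theta> s x * g x)"
proof (rule Bochner_Integration.integrable_bound)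
  show "integrable lborel (\<lambda>x. C * (normal_density \<theta> s x * (1 + x\<^sup>2)))"
    using integrable_normal_quadratic[OF s] by simp
  show "AE x in lborel. norm (normal_density \<theta> s x * g x) \<le> norm (C * (normal_density \<theta> s x * (1 + x\<^sup>2)))"
  proof (intro AE_I2)
    fix x
    have "C \<ge> 0" using bound[of 0] by simp
    then have "norm (C * (normal_density \<theta> s x * (1 + x\<^sup>2))) = normal_density \<theta> s x * (C * (1 + x\<^sup>2))"
      unfolding real_norm_def abs_mult by simp
    moreover have "norm (normal_density \<theta> s x * g x) = normal_density \<theta> s x * \<bar>g x\<bar>"
      unfolding real_norm_def abs_mult by simp
    ultimately show "norm (normal_density \<theta> s x * g x) \<le> norm (C * (normal_density \<theta> s x * (1 + x\<^sup>2)))"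
      using mult_left_mono[OF bound[of x] normal_density_nonneg[of \<theta> s x]] by linarith
  qed
qed measurable

lemma borel_measurable_marginal_density [measurable]:
  assumes [measurable]: "prior \<in> borel_measurable borel"
  shows "marginal_density prior s \<in> borel_measurable borel"
  unfolding marginal_density_def normal_density_def by measurable

lemma borel_measurable_log_likelihood_ratio [measurable]:
  assumes [measurable]: "prior \<in> borel_measurable borel"
  shows "log_likelihood_ratio prior \<theta> s \<in> borel_measurable borel"
  unfolding log_likelihood_ratio_def by measurable

lemma ln_normal_density:
  assumes "s > 0"
  shows "ln (normal_density \<theta> s x) = - ln (sqrt (2 * pi * s\<^sup>2)) - (x - \<theta>)\<^sup>2 / (2 * s\<^sup>2)"
  using assms unfolding normal_density_def by (simp add: ln_div ln_mult)

text \<open>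
  The logarithm of a normal density is itself quadratic, so quadratic growth passes from the
  logarithm of the marginal to the log-likelihood ratio, and normal second moments then give
  all integrability.
\<close>
lemma log_likelihood_ratio_growth:
  assumes s: "s > 0" and pos: "\<And>x. marginal_density prior s x > 0"
    and growth: "\<And>x. \<bar>ln (marginal_density prior s x)\<bar> \<le> C * (1 + x\<^sup>2)"
  obtains D where "\<And>x. \<bar>log_likelihood_ratio prior \<theta> s x\<bar> \<le> D * (1 + x\<^sup>2)"
proof
  define a where "a = \<bar>ln (sqrt (2 * pi * s\<^sup>2))\<bar>"
  define D where "D = a + (1 + \<theta>\<^sup>2) / s\<^sup>2 + C"
  fix x
  have "log_likelihood_ratio prior \<theta> s x = ln (normal_density \<theta> s x) - ln (marginal_density prior s x)"
    unfolding log_likelihood_ratio_def using pos[of x] normal_density_pos[OF s, of \<theta> x] by (simp add: ln_div)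
  then have "\<bar>log_likelihood_ratio prior \<theta> s x\<bar> \<le> a + (x - \<theta>)\<^sup>2 / (2 * s\<^sup>2) + C * (1 + x\<^sup>2)"
    using growth[of x] divide_nonneg_nonneg[of "(x - \<theta>)\<^sup>2" "2 * s\<^sup>2"] zero_le_power2[of "x - \<theta>"]
      zero_le_power2[of s]
    unfolding ln_normal_density[OF s] a_def by linarith
  also have "(x - \<theta>)\<^sup>2 / (2 * s\<^sup>2) \<le> (1 + \<theta>\<^sup>2) * (1 + x\<^sup>2) / s\<^sup>2"
  proof -
    have "(x - \<theta>)\<^sup>2 \<le> 2 * ((1 + \<theta>\<^sup>2) * (1 + x\<^sup>2))"
      using square_le_shifted[of x \<theta>] zero_le_power2[of "\<theta> * x"]
      unfolding power_mult_distrib distrib_left distrib_right by linarith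
    then have "(x - \<theta>)\<^sup>2 / (2 * s\<^sup>2) \<le> 2 * ((1 + \<theta>\<^sup>2) * (1 + x\<^sup>2)) / (2 * s\<^sup>2)"
      by (intro divide_right_mono) auto
    then show ?thesis by simp
  qed
  also have "a \<le> a * (1 + x\<^sup>2)"
    unfolding a_def by (simp add: algebra_simps)
  finally show "\<bar>log_likelihood_ratio prior \<theta> s x\<bar> \<le> D * (1 + x\<^sup>2)"
    by (simp add: D_def algebra_simps add_divide_distrib)
qed

lemma integrable_log_likelihood_ratio:
  assumes s: "s > 0" and [measurable]: "prior \<in> borel_measurable borel"
    and pos: "\<And>x. marginal_density prior s x > 0"
    and growth: "\<exists>C. \<forall>x. \<bar>ln (marginal_density prior s x)\<bar> \<le> C * (1 + x\<^sup>2)"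
  shows "integrable lborel (\<lambda>x. normal_density \<theta> s x * log_likelihood_ratio prior \<theta> s x)"
proof -
  obtain C where C: "\<And>x. \<bar>ln (marginal_density prior s x)\<bar> \<le> C * (1 + x\<^sup>2)"
    using growth by blast
  obtain D where D: "\<And>x. \<bar>log_likelihood_ratio prior \<theta> s x\<bar> \<le> D * (1 + x\<^sup>2)"
    using log_likelihood_ratio_growth[OF s pos C] by blast
  show ?thesis
    by (rule integrable_normal_quadratic_growth[OF s _ D]) measurable
qed

section \<open>The prediction risk as a difference of divergences\<close>

text \<open>
  The Bayes predictive risk is the chain rule for relative entropy in disguise: observing \<open>(Y, Z)\<close>
  amounts to observing the sufficient mean \<open>W\<close> of variance \<open>r / (1 + r)\<close>, and predicting \<open>Z\<close> from
  \<open>Y\<close> costs what is left of the divergence for \<open>W\<close> after that for \<open>Y\<close> has been paid.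
\<close>
theorem prediction_risk_eq_marginal_kl_diff:
  assumes r: "r > 0"
    and [measurable]: "prior \<in> borel_measurable borel"
    and pos: "\<And>s x. s > 0 \<Longrightarrow> marginal_density prior s x > 0"
    and growth: "\<And>s. s > 0 \<Longrightarrow> \<exists>C. \<forall>x. \<bar>ln (marginal_density prior s x)\<bar> \<le> C * (1 + x\<^sup>2)"
  shows "prediction_risk_converges r \<theta> (bayes_predictive_density r prior)"
    and "prediction_risk r \<theta> (bayes_predictive_density r prior) =
      marginal_kl prior \<theta> (sqrt (r / (1 + r))) - marginal_kl prior \<theta> 1"
proof -
  let ?p = "bayes_predictive_density r prior"
  define s where "s = sqrt (r / (1 + r))"
  define w where "w = (\<lambda>y z. (r * y + z) / (1 + r))"
  define K where "K = log_likelihood_ratio prior \<theta>"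
  have s: "s > 0" and sr: "sqrt r > 0" using r by (simp_all add: s_def)
  have [measurable]: "K t \<in> borel_measurable borel" for t unfolding K_def by measurable
  have "\<exists>D. \<forall>x. \<bar>K t x\<bar> \<le> D * (1 + x\<^sup>2)" if "t > 0" for t
    using growth[OF that] log_likelihood_ratio_growth[OF that pos[OF that]] unfolding K_def by metis
  then obtain Ds where Ds: "\<And>x. \<bar>K s x\<bar> \<le> Ds * (1 + x\<^sup>2)"
    using s by metis
  have Ds0: "Ds \<ge> 0" using Ds[of 0] by simp
  \<comment> \<open>\<open>w y z\<close> is a convex combination of \<open>y\<close> and \<open>z\<close>, so quadratic growth in it is quadratic growth in each.\<close>
  have w_sq: "(w y z)\<^sup>2 \<le> y\<^sup>2 + z\<^sup>2" for y z
  proof -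
    have "(1 + r) * (r * y\<^sup>2 + z\<^sup>2) - (r * y + z)\<^sup>2 = r * (y - z)\<^sup>2"
      by (simp add: power2_eq_square algebra_simps)
    then have "(r * y + z)\<^sup>2 \<le> (1 + r) * (r * y\<^sup>2 + z\<^sup>2)"
      using r by (smt (verit) mult_nonneg_nonneg zero_le_power2)
    also have "\<dots> \<le> (1 + r) * ((1 + r) * (y\<^sup>2 + z\<^sup>2))"
      using r by (intro mult_left_mono) (auto simp: algebra_simps)
    finally show ?thesis
      unfolding w_def using r by (simp add: power_divide divide_le_eq power2_eq_square mult_ac)
  qed
  have Kw: "\<bar>K s (w y z)\<bar> \<le> Ds * (1 + y\<^sup>2) * (1 + z\<^sup>2)" for y z
  proof -
    have "0 \<le> y\<^sup>2 * z\<^sup>2" by simp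
    then have "1 + (w y z)\<^sup>2 \<le> (1 + y\<^sup>2) * (1 + z\<^sup>2)"
      using w_sq[of y z] unfolding distrib_left distrib_right by linarith
    from mult_left_mono[OF this Ds0] show ?thesis using Ds[of "w y z"] by (simp add: mult.assoc)
  qed
  have [measurable]: "(\<lambda>z. K s (w y z)) \<in> borel_measurable borel" for y
    unfolding w_def by measurable
  have int_z: "integrable lborel (\<lambda>z. normal_density \<theta> (sqrt r) z * K s (w y z))" for y
    by (rule integrable_normal_quadratic_growth[OF sr _ Kw]) measurable
  have integrand: "normal_density \<theta> (sqrt r) z * ln (normal_density \<theta> (sqrt r) z / ?p y z) =
      normal_density \<theta> (sqrt r) z * K s (w y z) - K 1 y * normal_density \<theta> (sqrt r) z" for y z
  proof -
    have "ln (normal_density \<theta> (sqrt r) z / ?p y z) = K s (w y z) - K 1 y"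
      unfolding K_def s_def w_def by (rule ln_ratio_predictive[OF r pos])
    then show ?thesis by (simp only: right_diff_distrib mult.commute)
  qed
  define A where "A = (\<lambda>y. \<integral>z. normal_density \<theta> (sqrt r) z * K s (w y z) \<partial>lborel)"
  have loss: "prediction_loss r \<theta> ?p y = A y - K 1 y" for y
    unfolding prediction_loss_def integrand A_def using int_z[of y] sr by simp
  have A_meas [measurable]: "A \<in> borel_measurable borel"
    unfolding A_def w_def by measurable
  define M where "M = (\<integral>z. normal_density \<theta> (sqrt r) z * (1 + z\<^sup>2) \<partial>lborel)"
  have A_bound: "\<bar>A y\<bar> \<le> Ds * M * (1 + y\<^sup>2)" for y
  proof -
    have "\<bar>A y\<bar> \<le> (\<integral>z. \<bar>normal_density \<theta> (sqrt r) z * K s (w y z)\<bar> \<partial>lborel)"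
      unfolding A_def by (rule integral_abs_bound)
    also have "\<dots> \<le> (\<integral>z. Ds * (1 + y\<^sup>2) * (normal_density \<theta> (sqrt r) z * (1 + z\<^sup>2)) \<partial>lborel)"
    proof (rule integral_mono)
      show "integrable lborel (\<lambda>z. \<bar>normal_density \<theta> (sqrt r) z * K s (w y z)\<bar>)"
        using int_z by simp
      show "integrable lborel (\<lambda>z. Ds * (1 + y\<^sup>2) * (normal_density \<theta> (sqrt r) z * (1 + z\<^sup>2)))"
        using integrable_normal_quadratic[OF sr] by simp
      show "\<bar>normal_density \<theta> (sqrt r) z * K s (w y z)\<bar> \<le> Ds * (1 + y\<^sup>2) * (normal_density \<theta> (sqrt r) z * (1 + z\<^sup>2))" for z
        using mult_left_mono[OF Kw[of y z] normal_density_nonneg[of \<theta> "sqrt r" z]]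
        by (simp only: abs_mult abs_of_nonneg normal_density_nonneg mult_ac)
    qed
    also have "\<dots> = Ds * M * (1 + y\<^sup>2)" unfolding integral_mult_right_zero M_def by simp
    finally show ?thesis .
  qed
  have int_A: "integrable lborel (\<lambda>y. normal_density \<theta> 1 y * A y)"
    by (rule integrable_normal_quadratic_growth[OF _ A_meas A_bound]) simp
  have int_K1: "integrable lborel (\<lambda>y. normal_density \<theta> 1 y * K 1 y)"
    unfolding K_def by (rule integrable_log_likelihood_ratio[OF _ _ pos growth]) simp_all
  have int_Ks: "integrable lborel (\<lambda>y. normal_density \<theta> s y * K s y)"
    unfolding K_def using s by (intro integrable_log_likelihood_ratio pos growth) simp_all
  show "prediction_risk_converges r \<theta> ?p"
    unfolding prediction_risk_converges_def loss integrand using int_z int_A int_K1 sr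
    by (simp add: right_diff_distrib)
  have "prediction_risk r \<theta> ?p = (\<integral>y. normal_density \<theta> 1 y * A y \<partial>lborel) - marginal_kl prior \<theta> 1"
    unfolding prediction_risk_def loss marginal_kl_def K_def[symmetric] using int_A int_K1
    by (simp add: right_diff_distrib)
  also have "(\<integral>y. normal_density \<theta> 1 y * A y \<partial>lborel) = marginal_kl prior \<theta> s"
    unfolding A_def marginal_kl_def K_def[symmetric] w_def s_def
    by (rule normal_average_of_combination[OF r]) (use int_Ks in \<open>simp_all add: s_def\<close>)
  finally show "prediction_risk r \<theta> ?p = marginal_kl prior \<theta> (sqrt (r / (1 + r))) - marginal_kl prior \<theta> 1"
    unfolding s_def .
qed

section \<open>Jensen and Gibbs inequalities\<close>

text \<open>
  Jensen's inequality for the exponential and an average with weight \<open>f\<close>: the graph of \<open>exp\<close> lies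
  above its tangent at the mean of \<open>T\<close>.
\<close>
lemma exp_average_le:
  fixes f T :: "'a \<Rightarrow> real"
  assumes f: "integrable M f" "(\<integral>x. f x \<partial>M) = 1" "\<And>x. f x \<ge> 0"
    and T: "integrable M (\<lambda>x. f x * T x)" "integrable M (\<lambda>x. f x * exp (T x))"
  shows "exp (\<integral>x. f x * T x \<partial>M) \<le> (\<integral>x. f x * exp (T x) \<partial>M)"
proof -
  define c where "c = (\<integral>x. f x * T x \<partial>M)"
  have tangent: "exp c * ((1 - c) * f x + f x * T x) \<le> f x * exp (T x)" for x
  proof -
    have "exp c * (1 + (T x - c)) \<le> exp c * exp (T x - c)"
      by (intro mult_left_mono exp_ge_add_one_self) simp
    also have "\<dots> = exp (T x)" by (simp add: exp_diff)
    finally have "f x * (exp c * (1 + (T x - c))) \<le> f x * exp (T x)"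
      using f(3) by (intro mult_left_mono) auto
    then show ?thesis by (simp add: algebra_simps)
  qed
  have "exp c = (\<integral>x. exp c * ((1 - c) * f x + f x * T x) \<partial>M)"
    using f(1,2) T(1) by (simp add: c_def[symmetric])
  also have "\<dots> \<le> (\<integral>x. f x * exp (T x) \<partial>M)"
    using f(1) T tangent by (intro integral_mono) auto
  finally show ?thesis unfolding c_def .
qed

text \<open>
  By Fubini, smoothing by a normal kernel preserves mass.
\<close>
lemma integrable_marginal_density:
  assumes s: "s > 0" and prior: "integrable lborel prior" and nonneg: "\<And>\<mu>. prior \<mu> \<ge> 0"
  shows "integrable lborel (marginal_density prior s)"
    and "(\<integral>x. marginal_density prior s x \<partial>lborel) = (\<integral>\<mu>. prior \<mu> \<partial>lborel)"
proof -
  have [measurable]: "prior \<in> borel_measurable borel"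
    using borel_measurable_integrable[OF prior] by simp
  define F where "F = (\<lambda>(\<mu>, x). normal_density \<mu> s x * prior \<mu>)"
  have nd_meas: "(\<lambda>(\<mu>, x). normal_density \<mu> s x) \<in> borel_measurable (lborel \<Otimes>\<^sub>M lborel)"
    unfolding normal_density_def by measurable
  have Fm [measurable]: "F \<in> borel_measurable (lborel \<Otimes>\<^sub>M lborel)"
    using nd_meas unfolding F_def by measurable
  have nF: "norm (F (\<mu>, x)) = normal_density \<mu> s x * prior \<mu>" for \<mu> x
    using nonneg by (simp add: F_def abs_mult)
  have F_int: "integrable (lborel \<Otimes>\<^sub>M lborel) F"
  proof (rule lborel_pair.Fubini_integrable[OF Fm])
    show "integrable lborel (\<lambda>\<mu>. \<integral>x. norm (F (\<mu>, x)) \<partial>lborel)"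
      unfolding nF using prior s by simp
    show "AE \<mu> in lborel. integrable lborel (\<lambda>x. F (\<mu>, x))"
      unfolding F_def using s by simp
  qed
  have marg: "marginal_density prior s x = (\<integral>\<mu>. F (\<mu>, x) \<partial>lborel)" for x
    by (simp add: marginal_density_def F_def)
  have "integrable (lborel \<Otimes>\<^sub>M lborel) (\<lambda>(x, \<mu>). F (\<mu>, x))"
    using lborel_pair.integrable_product_swap[OF F_int] .
  from lborel_pair.integrable_fst'[OF this]
  have "integrable lborel (\<lambda>x. \<integral>\<mu>. F (\<mu>, x) \<partial>lborel)" by simp
  then show "integrable lborel (marginal_density prior s)"
    unfolding marg[symmetric] .
  have "(\<integral>x. marginal_density prior s x \<partial>lborel) = (\<integral>\<mu>. \<integral>x. F (\<mu>, x) \<partial>lborel \<partial>lborel)"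
    unfolding marg using lborel_pair.Fubini_integral[of "\<lambda>\<mu> x. F (\<mu>, x)"] F_int by simp
  also have "\<dots> = (\<integral>\<mu>. prior \<mu> \<partial>lborel)"
    unfolding F_def using s by simp
  finally show "(\<integral>x. marginal_density prior s x \<partial>lborel) = (\<integral>\<mu>. prior \<mu> \<partial>lborel)" .
qed

text \<open>
  Gibbs' inequality, from \<open>n ln (n / m) \<ge> n - m\<close> and the equal masses of the two densities.
\<close>
lemma marginal_kl_nonneg:
  assumes s: "s > 0" and prior: "integrable lborel prior" "\<And>\<mu>. prior \<mu> \<ge> 0" "(\<integral>\<mu>. prior \<mu> \<partial>lborel) = 1"
    and pos: "\<And>x. marginal_density prior s x > 0"
    and int: "integrable lborel (\<lambda>x. normal_density \<theta> s x * log_likelihood_ratio prior \<theta> s x)"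
  shows "marginal_kl prior \<theta> s \<ge> 0"
proof -
  have "normal_density \<theta> s x - marginal_density prior s x \<le>
      normal_density \<theta> s x * log_likelihood_ratio prior \<theta> s x" for x
  proof -
    define n m where "n = normal_density \<theta> s x" and "m = marginal_density prior s x"
    have nm: "n > 0" "m > 0" using pos normal_density_pos[OF s] by (auto simp: n_def m_def)
    have "ln (m / n) \<le> m / n - 1" using nm by (intro ln_le_minus_one) simp
    then have "n * (1 - m / n) \<le> n * ln (n / m)"
      using nm by (intro mult_left_mono) (auto simp: ln_div)
    then show ?thesis
      using nm unfolding log_likelihood_ratio_def n_def[symmetric] m_def[symmetric] by (simp add: algebra_simps)
  qed
  then have "(\<integral>x. normal_density \<theta> s x - marginal_density prior s x \<partial>lborel) \<le> marginal_kl prior \<theta> s"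
    unfolding marginal_kl_def using s int integrable_marginal_density(1)[OF s prior(1,2)]
    by (intro integral_mono) auto
  then show ?thesis
    using s integrable_marginal_density[OF s prior(1,2)] prior(3) by simp
qed

section \<open>Moments of the Laplace and normal distributions\<close>

text \<open>
  After rescaling by \<open>l\<close>, the two half-lines each contribute half of a Gamma integral.
\<close>
lemma has_bochner_integral_laplace_abs_moment:
  assumes l: "l > 0"
  shows "has_bochner_integral lborel (\<lambda>\<mu>. laplace_density l \<mu> * \<bar>l * \<mu>\<bar> ^ k) (fact k)"
proof -
  have "has_bochner_integral lborel (\<lambda>x::real. indicator {0..} x *\<^sub>R (\<bar>x\<bar> ^ k * exp (- \<bar>x\<bar>))) (fact k)"
  proof (rule has_bochner_integral_nn_integral)
    show "(\<integral>\<^sup>+x. ennreal (indicator {0..} x *\<^sub>R (\<bar>x\<bar> ^ k * exp (- \<bar>x\<bar>))) \<partial>lborel) = ennreal (fact k)"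
      using nn_intergal_power_times_exp_Ici[of k]
      by (auto intro!: nn_integral_cong simp: split: split_indicator elim!: trans[rotated])
  qed auto
  from has_bochner_integral_even_function[OF this]
  have "has_bochner_integral lborel (\<lambda>x::real. \<bar>x\<bar> ^ k * exp (- \<bar>x\<bar>)) (2 * fact k)" by simp
  then have "has_bochner_integral lborel (\<lambda>x::real. \<bar>l * x\<bar> ^ k * exp (- \<bar>l * x\<bar>)) (2 * fact k / l)"
    using l lborel_has_bochner_integral_real_affine_iff[of l "\<lambda>x::real. \<bar>x\<bar> ^ k * exp (- \<bar>x\<bar>)" "2 * fact k" 0]
    by (simp add: divide_inverse_commute)
  from has_bochner_integral_mult_right[OF this, of "l / 2"]
  show ?thesis
    using l by (simp add: laplace_density_def abs_mult mult_ac)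
qed

lemma laplace_density_nonneg: "l > 0 \<Longrightarrow> laplace_density l \<mu> \<ge> 0"
  by (simp add: laplace_density_def)

lemma laplace_density_le: "l > 0 \<Longrightarrow> laplace_density l \<mu> \<le> l / 2"
  by (simp add: laplace_density_def)

lemma borel_measurable_laplace_density [measurable]: "laplace_density l \<in> borel_measurable borel"
  unfolding laplace_density_def by measurable

lemma laplace_mass:
  assumes "l > 0"
  shows "integrable lborel (laplace_density l)" "(\<integral>\<mu>. laplace_density l \<mu> \<partial>lborel) = 1"
  using has_bochner_integral_laplace_abs_moment[OF assms, of 0] by (auto simp: has_bochner_integral_iff)

lemma laplace_mean:
  assumes l: "l > 0"
  shows "integrable lborel (\<lambda>\<mu>. laplace_density l \<mu> * \<mu>)" "(\<integral>\<mu>. laplace_density l \<mu> * \<mu> \<partial>lborel) = 0"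
proof -
  have "integrable lborel (\<lambda>\<mu>. laplace_density l \<mu> * \<bar>l * \<mu>\<bar>)"
    using has_bochner_integral_laplace_abs_moment[OF l, of 1] by (auto simp: has_bochner_integral_iff)
  then have "integrable lborel (\<lambda>\<mu>. 1 / l * (laplace_density l \<mu> * \<bar>l * \<mu>\<bar>))" by simp
  then show int: "integrable lborel (\<lambda>\<mu>. laplace_density l \<mu> * \<mu>)"
    by (rule Bochner_Integration.integrable_bound) (use l in \<open>auto simp: abs_mult\<close>)
  have "(\<integral>\<mu>. laplace_density l \<mu> * \<mu> \<partial>lborel) = (\<integral>\<mu>. laplace_density l (0 + (- 1) * \<mu>) * (0 + (- 1) * \<mu>) \<partial>lborel)"
    by (subst lborel_integral_real_affine[of "- 1" _ 0]) auto
  also have "\<dots> = - (\<integral>\<mu>. laplace_density l \<mu> * \<mu> \<partial>lborel)"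
    by (simp add: laplace_density_def)
  finally show "(\<integral>\<mu>. laplace_density l \<mu> * \<mu> \<partial>lborel) = 0" by simp
qed

lemma laplace_second_moment:
  assumes l: "l > 0"
  shows "integrable lborel (\<lambda>\<mu>. laplace_density l \<mu> * \<mu>\<^sup>2)" "(\<integral>\<mu>. laplace_density l \<mu> * \<mu>\<^sup>2 \<partial>lborel) = 2 / l\<^sup>2"
proof -
  have "has_bochner_integral lborel (\<lambda>\<mu>. 1 / l\<^sup>2 * (laplace_density l \<mu> * \<bar>l * \<mu>\<bar> ^ 2)) (1 / l\<^sup>2 * fact 2)"
    by (intro has_bochner_integral_mult_right has_bochner_integral_laplace_abs_moment[OF l])
  then have "has_bochner_integral lborel (\<lambda>\<mu>. laplace_density l \<mu> * \<mu>\<^sup>2) (2 / l\<^sup>2)"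
    using l by (simp add: power_mult_distrib)
  then show "integrable lborel (\<lambda>\<mu>. laplace_density l \<mu> * \<mu>\<^sup>2)" "(\<integral>\<mu>. laplace_density l \<mu> * \<mu>\<^sup>2 \<partial>lborel) = 2 / l\<^sup>2"
    by (auto simp: has_bochner_integral_iff)
qed

lemma normal_density_swap: "normal_density \<mu> s x = normal_density x s \<mu>"
  by (simp add: normal_density_def power2_commute)

lemma integrable_normal_laplace:
  assumes s: "s > 0" and l: "l > 0"
  shows "integrable lborel (\<lambda>\<mu>. normal_density x s \<mu> * laplace_density l \<mu>)"
proof (rule Bochner_Integration.integrable_bound)
  show "integrable lborel (\<lambda>\<mu>. l / 2 * normal_density x s \<mu>)" using s by simp
  show "AE \<mu> in lborel. norm (normal_density x s \<mu> * laplace_density l \<mu>) \<le> norm (l / 2 * normal_density x s \<mu>)"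
  proof (intro AE_I2)
    fix \<mu>
    have "normal_density x s \<mu> * laplace_density l \<mu> \<le> normal_density x s \<mu> * (l / 2)"
      using laplace_density_le[OF l] by (intro mult_left_mono) simp_all
    then show "norm (normal_density x s \<mu> * laplace_density l \<mu>) \<le> norm (l / 2 * normal_density x s \<mu>)"
      using l laplace_density_nonneg[OF l, of \<mu>] by (simp add: abs_mult mult_ac)
  qed
qed measurable

lemma integrable_normal_abs:
  assumes s: "s > 0"
  shows "integrable lborel (\<lambda>x. normal_density \<theta> s x * \<bar>x\<bar>)"
  using integrable_abs[OF integrable_normal_moment_nz_1[OF s, of \<theta>]] by (simp add: abs_mult)

lemma normal_abs_mean_le:
  assumes s: "s > 0"
  shows "(\<integral>x. normal_density \<theta> s x * \<bar>x\<bar> \<partial>lborel) \<le> \<bar>\<theta>\<bar> + s * sqrt (2 / pi)"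
proof -
  have int: "integrable lborel (\<lambda>x. normal_density \<theta> s x * \<bar>x - \<theta>\<bar>)"
    "(\<integral>x. normal_density \<theta> s x * \<bar>x - \<theta>\<bar> \<partial>lborel) = s * sqrt (2 / pi)"
    using normal_moment_abs_odd[OF s, of \<theta> 0] by (auto simp: has_bochner_integral_iff)
  have "(\<integral>x. normal_density \<theta> s x * \<bar>x\<bar> \<partial>lborel) \<le>
      (\<integral>x. \<bar>\<theta>\<bar> * normal_density \<theta> s x + normal_density \<theta> s x * \<bar>x - \<theta>\<bar> \<partial>lborel)"
  proof (rule integral_mono)
    show "normal_density \<theta> s x * \<bar>x\<bar> \<le> \<bar>\<theta>\<bar> * normal_density \<theta> s x + normal_density \<theta> s x * \<bar>x - \<theta>\<bar>" for x
      using mult_left_mono[of "\<bar>x\<bar>" "\<bar>\<theta>\<bar> + \<bar>x - \<theta>\<bar>" "normal_density \<theta> s x"]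
      by (simp add: algebra_simps)
  qed (use s int integrable_normal_abs[OF s] in auto)
  then show ?thesis using s int by simp
qed

text \<open>
  A normal variable spreads out as its variance grows, so the mean of the convex function
  \<open>\<bar>x\<bar>\<close> increases. Concretely, \<open>\<theta> + s N = (1 - s) \<theta> + s (\<theta> + N)\<close> is a convex combination of
  the constant \<open>\<theta>\<close> and of \<open>\<theta> + N\<close>, and \<open>\<bar>\<theta>\<bar>\<close> is at most the mean of \<open>\<bar>\<theta> + N\<bar>\<close>.
\<close>
lemma normal_abs_mean_mono:
  assumes s: "0 < s" "s \<le> 1"
  shows "(\<integral>x. normal_density \<theta> s x * \<bar>x\<bar> \<partial>lborel) \<le> (\<integral>x. normal_density \<theta> 1 x * \<bar>x\<bar> \<partial>lborel)"
proof -
  define E where "E = (\<integral>x. normal_density \<theta> 1 x * \<bar>x\<bar> \<partial>lborel)"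
  have int1: "integrable lborel (\<lambda>x. normal_density \<theta> 1 x * \<bar>x\<bar>)"
    by (rule integrable_normal_abs) simp
  have scale: "s * normal_density \<theta> s ((1 - s) * \<theta> + s * x) = normal_density \<theta> 1 x" for x
  proof -
    have "(1 - s) * \<theta> + s * x - \<theta> = s * (x - \<theta>)" by (simp add: algebra_simps)
    then show ?thesis using s unfolding normal_density_def by (simp add: power_mult_distrib real_sqrt_mult)
  qed
  have "(\<integral>x. normal_density \<theta> s x * \<bar>x\<bar> \<partial>lborel) =
      (\<integral>x. s * normal_density \<theta> s ((1 - s) * \<theta> + s * x) * \<bar>(1 - s) * \<theta> + s * x\<bar> \<partial>lborel)"
    using s by (subst lborel_integral_real_affine[of s _ "(1 - s) * \<theta>"]) (auto simp: mult.assoc)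
  also have "\<dots> = (\<integral>x. normal_density \<theta> 1 x * \<bar>(1 - s) * \<theta> + s * x\<bar> \<partial>lborel)"
    unfolding scale ..
  also have "\<dots> \<le> (\<integral>x. (1 - s) * \<bar>\<theta>\<bar> * normal_density \<theta> 1 x + s * (normal_density \<theta> 1 x * \<bar>x\<bar>) \<partial>lborel)"
  proof (rule integral_mono)
    have "integrable lborel (\<lambda>x. (1 - s) * \<theta> * normal_density \<theta> 1 x + s * (normal_density \<theta> 1 x * x))"
      using integrable_normal_moment_nz_1[of 1 \<theta>] by simp
    from integrable_abs[OF this]
    have "integrable lborel (\<lambda>x. \<bar>normal_density \<theta> 1 x * ((1 - s) * \<theta> + s * x)\<bar>)"
      by (simp add: algebra_simps)
    then show "integrable lborel (\<lambda>x. normal_density \<theta> 1 x * \<bar>(1 - s) * \<theta> + s * x\<bar>)"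
      by (simp add: abs_mult)
    show "integrable lborel (\<lambda>x. (1 - s) * \<bar>\<theta>\<bar> * normal_density \<theta> 1 x + s * (normal_density \<theta> 1 x * \<bar>x\<bar>))"
      using int1 by simp
    show "normal_density \<theta> 1 x * \<bar>(1 - s) * \<theta> + s * x\<bar> \<le>
        (1 - s) * \<bar>\<theta>\<bar> * normal_density \<theta> 1 x + s * (normal_density \<theta> 1 x * \<bar>x\<bar>)" for x
    proof -
      have "\<bar>(1 - s) * \<theta> + s * x\<bar> \<le> (1 - s) * \<bar>\<theta>\<bar> + s * \<bar>x\<bar>"
        using s abs_triangle_ineq[of "(1 - s) * \<theta>" "s * x"] by (simp add: abs_mult)
      from mult_left_mono[OF this normal_density_nonneg[of \<theta> 1 x]]
      show ?thesis by (simp add: algebra_simps)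
    qed
  qed
  also have "\<dots> = (1 - s) * \<bar>\<theta>\<bar> + s * E"
    using int1 by (simp add: E_def)
  also have "\<bar>\<theta>\<bar> \<le> E"
  proof -
    have "\<bar>\<integral>x. normal_density \<theta> 1 x * x \<partial>lborel\<bar> \<le> (\<integral>x. \<bar>normal_density \<theta> 1 x * x\<bar> \<partial>lborel)"
      by (rule integral_abs_bound)
    then show ?thesis by (simp add: E_def abs_mult integral_normal_moment_nz_1)
  qed
  then have "(1 - s) * \<bar>\<theta>\<bar> + s * E \<le> (1 - s) * E + s * E"
    using s by (intro add_right_mono mult_left_mono) auto
  finally show ?thesis by (simp add: E_def algebra_simps)
qed

section \<open>The marginal density under the Laplace prior\<close>

text \<open>
  Jensen's inequality with respect to the normal kernel, where the mean of \<open>\<bar>\<mu>\<bar>\<close> is at most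
  \<open>\<bar>x\<bar> + s sqrt (2 / \<pi>)\<close>.
\<close>
lemma laplace_marginal_ge:
  assumes s: "s > 0" and l: "l > 0"
  shows "l / 2 * exp (- l * (\<bar>x\<bar> + s * sqrt (2 / pi))) \<le> marginal_density (laplace_density l) s x"
proof -
  have T: "integrable lborel (\<lambda>\<mu>. normal_density x s \<mu> * (- l * \<bar>\<mu>\<bar>))"
    using integrable_mult_right[OF integrable_normal_abs[OF s, of x], of "- l"] by (simp add: mult_ac)
  have "integrable lborel (\<lambda>\<mu>. 2 / l * (normal_density x s \<mu> * laplace_density l \<mu>))"
    using integrable_normal_laplace[OF s l] by simp
  then have eT: "integrable lborel (\<lambda>\<mu>. normal_density x s \<mu> * exp (- l * \<bar>\<mu>\<bar>))"
    using l by (simp add: laplace_density_def mult_ac)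
  have "(\<integral>\<mu>. normal_density x s \<mu> * (- l * \<bar>\<mu>\<bar>) \<partial>lborel) = - l * (\<integral>\<mu>. normal_density x s \<mu> * \<bar>\<mu>\<bar> \<partial>lborel)"
    by (subst integral_mult_right_zero[symmetric]) (simp add: mult_ac)
  then have "- l * (\<bar>x\<bar> + s * sqrt (2 / pi)) \<le> (\<integral>\<mu>. normal_density x s \<mu> * (- l * \<bar>\<mu>\<bar>) \<partial>lborel)"
    using mult_left_mono[OF normal_abs_mean_le[OF s, of x], of l] l by simp
  then have "exp (- l * (\<bar>x\<bar> + s * sqrt (2 / pi))) \<le> exp (\<integral>\<mu>. normal_density x s \<mu> * (- l * \<bar>\<mu>\<bar>) \<partial>lborel)"
    by simp
  also have "\<dots> \<le> (\<integral>\<mu>. normal_density x s \<mu> * exp (- l * \<bar>\<mu>\<bar>) \<partial>lborel)"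
    using s by (intro exp_average_le T eT) auto
  finally have "l / 2 * exp (- l * (\<bar>x\<bar> + s * sqrt (2 / pi))) \<le>
      l / 2 * (\<integral>\<mu>. normal_density x s \<mu> * exp (- l * \<bar>\<mu>\<bar>) \<partial>lborel)"
    using l by (intro mult_left_mono) auto
  also have "\<dots> = marginal_density (laplace_density l) s x"
    unfolding marginal_density_def normal_density_swap[of _ s x]
    by (subst integral_mult_right_zero[symmetric]) (simp add: laplace_density_def mult_ac)
  finally show ?thesis .
qed

text \<open>
  Replacing \<open>\<bar>\<mu>\<bar>\<close> by the smaller linear function \<open>e \<mu>\<close>, where \<open>e\<close> is the sign of \<open>x\<close>, turns the
  integral into the normal moment generating function.
\<close>
lemma laplace_marginal_le:
  assumes s: "s > 0" and l: "l > 0"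
  shows "marginal_density (laplace_density l) s x \<le> l / 2 * exp (- l * \<bar>x\<bar> + l\<^sup>2 * s\<^sup>2 / 2)"
proof -
  define e :: real where "e = (if x \<ge> 0 then 1 else - 1)"
  have e: "e * x = \<bar>x\<bar>" "e * \<mu> \<le> \<bar>\<mu>\<bar>" "e\<^sup>2 = 1" for \<mu> by (auto simp: e_def)
  have tilt: "normal_density x s \<mu> * exp (- l * (e * \<mu>)) =
      exp (- l * \<bar>x\<bar> + l\<^sup>2 * s\<^sup>2 / 2) * normal_density (x - l * e * s\<^sup>2) s \<mu>" for \<mu>
  proof -
    have "(\<mu> - (x - l * e * s\<^sup>2))\<^sup>2 = (\<mu> - x)\<^sup>2 + 2 * s\<^sup>2 * (l * (e * \<mu>) - l * (e * x)) + e\<^sup>2 * l\<^sup>2 * s\<^sup>2 * s\<^sup>2"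
      by (simp add: power2_eq_square algebra_simps)
    then have "(\<mu> - (x - l * e * s\<^sup>2))\<^sup>2 / (2 * s\<^sup>2) =
        (\<mu> - x)\<^sup>2 / (2 * s\<^sup>2) + (l * (e * \<mu>) - l * \<bar>x\<bar>) + l\<^sup>2 * s\<^sup>2 / 2"
      using s unfolding e by (simp add: add_divide_distrib)
    then have "- (\<mu> - x)\<^sup>2 / (2 * s\<^sup>2) + (- l * (e * \<mu>)) =
      (- l * \<bar>x\<bar> + l\<^sup>2 * s\<^sup>2 / 2) + - (\<mu> - (x - l * e * s\<^sup>2))\<^sup>2 / (2 * s\<^sup>2)" by simp
    then show ?thesis
      unfolding normal_density_def by (simp only: mult.assoc mult.left_commute[of "exp (- l * \<bar>x\<bar> + l\<^sup>2 * s\<^sup>2 / 2)"] exp_add[symmetric])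
  qed
  have "marginal_density (laplace_density l) s x = (\<integral>\<mu>. normal_density x s \<mu> * laplace_density l \<mu> \<partial>lborel)"
    unfolding marginal_density_def normal_density_swap[of _ s x] ..
  also have "\<dots> \<le> (\<integral>\<mu>. l / 2 * exp (- l * \<bar>x\<bar> + l\<^sup>2 * s\<^sup>2 / 2) * normal_density (x - l * e * s\<^sup>2) s \<mu> \<partial>lborel)"
  proof (rule integral_mono)
    show "normal_density x s \<mu> * laplace_density l \<mu> \<le>
        l / 2 * exp (- l * \<bar>x\<bar> + l\<^sup>2 * s\<^sup>2 / 2) * normal_density (x - l * e * s\<^sup>2) s \<mu>" for \<mu>
    proof -
      have "laplace_density l \<mu> \<le> l / 2 * exp (- l * (e * \<mu>))"
        using l e(2)[of \<mu>] by (simp add: laplace_density_def)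
      from mult_left_mono[OF this normal_density_nonneg[of x s \<mu>]]
      show ?thesis using tilt[of \<mu>] by (simp add: mult_ac)
    qed
  qed (use s l integrable_normal_laplace[OF s l] in auto)
  also have "\<dots> = l / 2 * exp (- l * \<bar>x\<bar> + l\<^sup>2 * s\<^sup>2 / 2)" using s by simp
  finally show ?thesis .
qed

text \<open>
  Jensen's inequality with respect to the prior this time. The likelihood is the centred normal
  density times \<open>exp (T \<mu>)\<close>, where \<open>T \<mu> = x \<mu> / s\<^sup>2 - \<mu>\<^sup>2 / (2 s\<^sup>2)\<close>. The linear term has prior mean
  zero by symmetry, and the prior variance \<open>2 / l\<^sup>2\<close> gives \<open>T\<close> the mean \<open>- 1 / (l\<^sup>2 s\<^sup>2)\<close>, whatever
  \<open>x\<close> is.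
\<close>
lemma laplace_marginal_ge_centred_normal:
  assumes s: "s > 0" and l: "l > 0"
  shows "normal_density 0 s x * exp (- 1 / (l\<^sup>2 * s\<^sup>2)) \<le> marginal_density (laplace_density l) s x"
proof -
  define T where "T = (\<lambda>\<mu>. x / s\<^sup>2 * \<mu> - 1 / (2 * s\<^sup>2) * \<mu>\<^sup>2)"
  have factor: "normal_density \<mu> s x = normal_density 0 s x * exp (T \<mu>)" for \<mu>
  proof -
    have "(x - \<mu>)\<^sup>2 / (2 * s\<^sup>2) = x\<^sup>2 / (2 * s\<^sup>2) - T \<mu>"
      using s unfolding T_def by (simp add: field_simps power2_eq_square)
    then have "exp (- (x - \<mu>)\<^sup>2 / (2 * s\<^sup>2)) = exp (- x\<^sup>2 / (2 * s\<^sup>2)) * exp (T \<mu>)"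
      unfolding exp_add[symmetric] by simp
    then show ?thesis unfolding normal_density_def by simp
  qed
  have n0: "normal_density 0 s x > 0" using normal_density_pos[OF s] .
  have fT: "laplace_density l \<mu> * T \<mu> = x / s\<^sup>2 * (laplace_density l \<mu> * \<mu>) - 1 / (2 * s\<^sup>2) * (laplace_density l \<mu> * \<mu>\<^sup>2)" for \<mu>
    unfolding T_def by (simp add: algebra_simps)
  have int_T: "integrable lborel (\<lambda>\<mu>. laplace_density l \<mu> * T \<mu>)"
    unfolding fT using laplace_mean[OF l] laplace_second_moment[OF l] by simp
  have mean_T: "(\<integral>\<mu>. laplace_density l \<mu> * T \<mu> \<partial>lborel) = - 1 / (l\<^sup>2 * s\<^sup>2)"
    unfolding fT using laplace_mean[OF l] laplace_second_moment[OF l] by simp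
  have "laplace_density l \<mu> * exp (T \<mu>) =
      1 / normal_density 0 s x * (normal_density x s \<mu> * laplace_density l \<mu>)" for \<mu>
    using n0 factor[of \<mu>] unfolding normal_density_swap[of x s] by simp
  then have int_eT: "integrable lborel (\<lambda>\<mu>. laplace_density l \<mu> * exp (T \<mu>))"
    using integrable_normal_laplace[OF s l, of x] by simp
  have "exp (- 1 / (l\<^sup>2 * s\<^sup>2)) \<le> (\<integral>\<mu>. laplace_density l \<mu> * exp (T \<mu>) \<partial>lborel)"
    unfolding mean_T[symmetric]
    using laplace_mass[OF l] laplace_density_nonneg[OF l] int_T int_eT by (intro exp_average_le)
  then have "normal_density 0 s x * exp (- 1 / (l\<^sup>2 * s\<^sup>2)) \<le>
      normal_density 0 s x * (\<integral>\<mu>. laplace_density l \<mu> * exp (T \<mu>) \<partial>lborel)"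
    using n0 by (intro mult_left_mono) auto
  also have "\<dots> = marginal_density (laplace_density l) s x"
    unfolding marginal_density_def integral_mult_right_zero[symmetric]
  proof (intro Bochner_Integration.integral_cong refl)
    show "normal_density 0 s x * (laplace_density l \<mu> * exp (T \<mu>)) = normal_density \<mu> s x * laplace_density l \<mu>" for \<mu>
      using factor[of \<mu>] by simp
  qed
  finally show ?thesis .
qed

lemma laplace_marginal_pos:
  assumes "s > 0" "l > 0"
  shows "marginal_density (laplace_density l) s x > 0"
  using assms by (intro less_le_trans[OF _ laplace_marginal_ge]) auto

lemma ln_laplace_marginal_le:
  assumes s: "s > 0" and l: "l > 0"
  shows "ln (marginal_density (laplace_density l) s x) \<le> ln (l / 2) - l * \<bar>x\<bar> + l\<^sup>2 * s\<^sup>2 / 2"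
proof -
  have "ln (marginal_density (laplace_density l) s x) \<le> ln (l / 2 * exp (- l * \<bar>x\<bar> + l\<^sup>2 * s\<^sup>2 / 2))"
    using laplace_marginal_le[OF s l, of x] laplace_marginal_pos[OF s l, of x] by simp
  also have "\<dots> = ln (l / 2) + (- l * \<bar>x\<bar> + l\<^sup>2 * s\<^sup>2 / 2)"
    using l by (subst ln_mult) auto
  finally show ?thesis by simp
qed

lemma ln_laplace_marginal_ge:
  assumes s: "s > 0" and l: "l > 0"
  shows "ln (l / 2) - l * \<bar>x\<bar> - l * s * sqrt (2 / pi) \<le> ln (marginal_density (laplace_density l) s x)"
proof -
  have "ln (l / 2) + (- l * (\<bar>x\<bar> + s * sqrt (2 / pi))) = ln (l / 2 * exp (- l * (\<bar>x\<bar> + s * sqrt (2 / pi))))"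
    using l by (subst ln_mult) auto
  also have "\<dots> \<le> ln (marginal_density (laplace_density l) s x)"
    using laplace_marginal_ge[OF s l, of x] l laplace_marginal_pos[OF s l, of x] by (subst ln_le_cancel_iff) auto
  finally show ?thesis by (simp add: algebra_simps)
qed

lemma ln_laplace_marginal_growth:
  assumes s: "s > 0" and l: "l > 0"
  shows "\<exists>C. \<forall>x. \<bar>ln (marginal_density (laplace_density l) s x)\<bar> \<le> C * (1 + x\<^sup>2)"
proof (intro exI allI)
  fix x
  define c where "c = \<bar>ln (l / 2)\<bar> + l * s * sqrt (2 / pi) + l\<^sup>2 * s\<^sup>2 / 2"
  have nn: "l * s * sqrt (2 / pi) \<ge> 0" "l\<^sup>2 * s\<^sup>2 / 2 \<ge> 0" using s l by auto
  have c: "c \<ge> 0" using nn unfolding c_def by linarith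
  have lx: "l * \<bar>x\<bar> \<le> l * (1 + x\<^sup>2)"
  proof -
    have "0 \<le> (1 - \<bar>x\<bar>)\<^sup>2" by simp
    then have "2 * \<bar>x\<bar> \<le> 1 + x\<^sup>2" by (simp add: power2_diff)
    then have "\<bar>x\<bar> \<le> 1 + x\<^sup>2" by linarith
    then show ?thesis using l by (intro mult_left_mono) auto
  qed
  have "0 \<le> l * \<bar>x\<bar>" using l by simp
  then have "\<bar>ln (marginal_density (laplace_density l) s x)\<bar> \<le> c + l * \<bar>x\<bar>"
    using ln_laplace_marginal_le[OF s l, of x] ln_laplace_marginal_ge[OF s l, of x] nn
    unfolding c_def by linarith
  also have "\<dots> \<le> c * (1 + x\<^sup>2) + l * (1 + x\<^sup>2)"
    using lx mult_left_mono[of 1 "1 + x\<^sup>2" c] c by simp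
  finally show "\<bar>ln (marginal_density (laplace_density l) s x)\<bar> \<le>
      (\<bar>ln (l / 2)\<bar> + l * s * sqrt (2 / pi) + l\<^sup>2 * s\<^sup>2 / 2 + l) * (1 + x\<^sup>2)"
    unfolding c_def by (simp add: distrib_right)
qed

section \<open>Bounds for the divergences and the risk\<close>

lemma laplace_marginal_kl_zero_le:
  assumes s: "s > 0" and l: "l > 0"
  shows "marginal_kl (laplace_density l) 0 s \<le> 1 / (l\<^sup>2 * s\<^sup>2)"
proof -
  let ?m = "marginal_density (laplace_density l) s"
  have "log_likelihood_ratio (laplace_density l) 0 s x \<le> 1 / (l\<^sup>2 * s\<^sup>2)" for x
  proof -
    have "ln (normal_density 0 s x) - 1 / (l\<^sup>2 * s\<^sup>2) = ln (normal_density 0 s x * exp (- 1 / (l\<^sup>2 * s\<^sup>2)))"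
      using normal_density_pos[OF s, of 0 x] by (subst ln_mult) auto
    also have "\<dots> \<le> ln (?m x)"
      using laplace_marginal_ge_centred_normal[OF s l, of x] normal_density_pos[OF s, of 0 x]
        laplace_marginal_pos[OF s l, of x] by (subst ln_le_cancel_iff) auto
    finally show ?thesis
      unfolding log_likelihood_ratio_def
      using normal_density_pos[OF s, of 0 x] laplace_marginal_pos[OF s l, of x] by (simp add: ln_div)
  qed
  then have "marginal_kl (laplace_density l) 0 s \<le> (\<integral>x. normal_density 0 s x * (1 / (l\<^sup>2 * s\<^sup>2)) \<partial>lborel)"
    unfolding marginal_kl_def
    using s l laplace_marginal_pos[OF s l] ln_laplace_marginal_growth[OF s l]
    by (intro integral_mono integrable_log_likelihood_ratio mult_left_mono) auto
  also have "\<dots> = 1 / (l\<^sup>2 * s\<^sup>2)" using s by simp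
  finally show ?thesis .
qed

text \<open>
  The marginal is trapped between two multiples of \<open>exp (- l \<bar>x\<bar>)\<close>. This is the divergence from
  \<open>N(\<theta>, s\<^sup>2)\<close> to such a multiple, with the normal entropy in closed form.
\<close>
lemma normal_kl_to_laplace_multiple:
  assumes s: "s > 0"
  shows "integrable lborel (\<lambda>x. normal_density \<theta> s x * (ln (normal_density \<theta> s x) + l * \<bar>x\<bar> + c))"
    and "(\<integral>x. normal_density \<theta> s x * (ln (normal_density \<theta> s x) + l * \<bar>x\<bar> + c) \<partial>lborel) =
      c - ln (sqrt (2 * pi * s\<^sup>2)) - 1 / 2 + l * (\<integral>x. normal_density \<theta> s x * \<bar>x\<bar> \<partial>lborel)"
proof -
  have eq: "normal_density \<theta> s x * (ln (normal_density \<theta> s x) + l * \<bar>x\<bar> + c) =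
      (c - ln (sqrt (2 * pi * s\<^sup>2))) * normal_density \<theta> s x -
      1 / (2 * s\<^sup>2) * (normal_density \<theta> s x * (x - \<theta>)\<^sup>2) + l * (normal_density \<theta> s x * \<bar>x\<bar>)" for x
    unfolding ln_normal_density[OF s] by (simp add: algebra_simps)
  have sq: "integrable lborel (\<lambda>x. normal_density \<theta> s x * (x - \<theta>)\<^sup>2)"
    "(\<integral>x. normal_density \<theta> s x * (x - \<theta>)\<^sup>2 \<partial>lborel) = s\<^sup>2"
    using normal_moment_even[OF s, of \<theta> 1] by (auto simp: has_bochner_integral_iff)
  show "integrable lborel (\<lambda>x. normal_density \<theta> s x * (ln (normal_density \<theta> s x) + l * \<bar>x\<bar> + c))"
    unfolding eq using s sq integrable_normal_abs[OF s] by simp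
  show "(\<integral>x. normal_density \<theta> s x * (ln (normal_density \<theta> s x) + l * \<bar>x\<bar> + c) \<partial>lborel) =
      c - ln (sqrt (2 * pi * s\<^sup>2)) - 1 / 2 + l * (\<integral>x. normal_density \<theta> s x * \<bar>x\<bar> \<partial>lborel)"
    unfolding eq using s sq integrable_normal_abs[OF s] by simp
qed

text \<open>
  Both bounds share the leading term \<open>E\<close>, whose dependence on \<open>\<theta>\<close> is only through the mean of
  \<open>\<bar>x\<bar>\<close>; the growth of order \<open>l \<bar>\<theta>\<bar>\<close> therefore drops out when two divergences are subtracted.
\<close>
lemma laplace_marginal_kl_bounds:
  fixes \<theta> :: real
  assumes s: "s > 0" and l: "l > 0"
  defines "E \<equiv> l * (\<integral>x. normal_density \<theta> s x * \<bar>x\<bar> \<partial>lborel) - ln (sqrt (2 * pi * s\<^sup>2)) - 1 / 2 - ln (l / 2)"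
  shows "marginal_kl (laplace_density l) \<theta> s \<le> E + l * s * sqrt (2 / pi)"
    and "E - l\<^sup>2 * s\<^sup>2 / 2 \<le> marginal_kl (laplace_density l) \<theta> s"
proof -
  let ?K = "log_likelihood_ratio (laplace_density l) \<theta> s"
  have K: "?K x = ln (normal_density \<theta> s x) - ln (marginal_density (laplace_density l) s x)" for x
    unfolding log_likelihood_ratio_def
    using normal_density_pos[OF s, of \<theta> x] laplace_marginal_pos[OF s l, of x] by (simp add: ln_div)
  have int: "integrable lborel (\<lambda>x. normal_density \<theta> s x * ?K x)"
    using s l laplace_marginal_pos[OF s l] ln_laplace_marginal_growth[OF s l]
    by (intro integrable_log_likelihood_ratio) auto
  note affine = normal_kl_to_laplace_multiple[OF s, of \<theta> l]
  have "marginal_kl (laplace_density l) \<theta> s \<le>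
      (\<integral>x. normal_density \<theta> s x * (ln (normal_density \<theta> s x) + l * \<bar>x\<bar> + (l * s * sqrt (2 / pi) - ln (l / 2))) \<partial>lborel)"
    unfolding marginal_kl_def
  proof (intro integral_mono int affine(1) mult_left_mono normal_density_nonneg)
    show "?K x \<le> ln (normal_density \<theta> s x) + l * \<bar>x\<bar> + (l * s * sqrt (2 / pi) - ln (l / 2))" for x
      unfolding K using ln_laplace_marginal_ge[OF s l, of x] by linarith
  qed
  then show "marginal_kl (laplace_density l) \<theta> s \<le> E + l * s * sqrt (2 / pi)"
    unfolding affine(2) E_def by simp
  have "(\<integral>x. normal_density \<theta> s x * (ln (normal_density \<theta> s x) + l * \<bar>x\<bar> + (- ln (l / 2) - l\<^sup>2 * s\<^sup>2 / 2)) \<partial>lborel)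
      \<le> marginal_kl (laplace_density l) \<theta> s"
    unfolding marginal_kl_def
  proof (intro integral_mono int affine(1) mult_left_mono normal_density_nonneg)
    show "ln (normal_density \<theta> s x) + l * \<bar>x\<bar> + (- ln (l / 2) - l\<^sup>2 * s\<^sup>2 / 2) \<le> ?K x" for x
      unfolding K using ln_laplace_marginal_le[OF s l, of x] by linarith
  qed
  then show "E - l\<^sup>2 * s\<^sup>2 / 2 \<le> marginal_kl (laplace_density l) \<theta> s"
    unfolding affine(2) E_def by simp
qed

text \<open>
  The part of the bound for \<open>\<theta> \<noteq> 0\<close> that is left over once the risk estimate has been subtracted.
\<close>
lemma log_slack_nonneg:
  assumes l: "l > (0::real)"
  shows "0 \<le> ln (sqrt (32 * l\<^sup>2 * pi)) + 4 / l\<^sup>2"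
proof -
  define u where "u = sqrt (32 * l\<^sup>2 * pi)"
  have u: "u > 0" using l by (simp add: u_def)
  have u2: "u\<^sup>2 = 32 * pi * l\<^sup>2" using l by (simp add: u_def)
  \<comment> \<open>The elementary bound \<open>ln x \<le> x - 1\<close> suffices because \<open>32 \<pi> \<ge> 1\<close>.\<close>
  have "ln (1 / u\<^sup>2) \<le> 1 / u\<^sup>2 - 1" using u by (intro ln_le_minus_one) simp
  then have "- 2 * ln u \<le> 1 / u\<^sup>2" using u by (simp add: ln_div ln_realpow)
  also have "1 / u\<^sup>2 \<le> 1 / l\<^sup>2"
    unfolding u2 using l pi_gt3 by (intro divide_left_mono) auto
  also have "\<dots> \<le> 8 / l\<^sup>2" by (intro divide_right_mono) auto
  finally show ?thesis unfolding u_def[symmetric] by simp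
qed

theorem theorem1:
  fixes r v l :: real and p :: "real \<Rightarrow> real \<Rightarrow> real"
  assumes "r > 0" and "v = 1 / (1 + 1 / r)" and "l > 0"
    and "p = bayes_predictive_density r (laplace_density l)"
  shows "(\<forall>\<theta>. prediction_risk_converges r \<theta> p) \<and>
    prediction_risk r 0 p \<le> ln (1 + sqrt 2 / (l * sqrt (pi * v))) + 4 / (l\<^sup>2 * v) \<and>
    (SUP \<theta>\<in>UNIV - {0}. ereal (prediction_risk r \<theta> p))
      \<le> ereal (ln (sqrt (32 * l\<^sup>2 * pi / v)) + l\<^sup>2 / 2 + l * sqrt (2 / pi) + 4 / l\<^sup>2)"
proof -
  define s where "s = sqrt (r / (1 + r))"
  have r: "r > 0" and l: "l > 0" by fact+
  have s: "s > 0" "s \<le> 1" using r by (auto simp: s_def)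
  have v: "v = r / (1 + r)" using assms(1,2) by (simp add: field_simps)
  then have v_pos: "v > 0" and s2: "s\<^sup>2 = v" using r by (auto simp: s_def)
  note pos = laplace_marginal_pos[OF _ l] and growth = ln_laplace_marginal_growth[OF _ l]
  have conv: "prediction_risk_converges r \<theta> p" for \<theta>
    unfolding assms(4) by (rule prediction_risk_eq_marginal_kl_diff(1)[OF r _ pos growth]) simp_all
  have risk: "prediction_risk r \<theta> p = marginal_kl (laplace_density l) \<theta> s - marginal_kl (laplace_density l) \<theta> 1" for \<theta>
    unfolding assms(4) s_def by (rule prediction_risk_eq_marginal_kl_diff(2)[OF r _ pos growth]) simp_all
  \<comment> \<open>At the origin the divergence for \<open>Y\<close> is dropped and that for \<open>W\<close> is at most \<open>1 / (l\<^sup>2 v)\<close>.\<close>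
  have "marginal_kl (laplace_density l) 0 1 \<ge> 0"
    using laplace_mass[OF l] laplace_density_nonneg[OF l] pos growth
    by (intro marginal_kl_nonneg integrable_log_likelihood_ratio) auto
  then have "prediction_risk r 0 p \<le> 1 / (l\<^sup>2 * v)"
    unfolding risk using laplace_marginal_kl_zero_le[OF s(1) l] by (simp add: s2)
  moreover have "1 / (l\<^sup>2 * v) \<le> 4 / (l\<^sup>2 * v)"
    using l v_pos by (intro divide_right_mono) auto
  moreover have "0 \<le> ln (1 + sqrt 2 / (l * sqrt (pi * v)))"
    using l v_pos by (intro ln_ge_zero) simp
  ultimately have zero: "prediction_risk r 0 p \<le> ln (1 + sqrt 2 / (l * sqrt (pi * v))) + 4 / (l\<^sup>2 * v)"
    by linarith
  have nonzero: "prediction_risk r \<theta> p \<le> ln (sqrt (32 * l\<^sup>2 * pi / v)) + l\<^sup>2 / 2 + l * sqrt (2 / pi) + 4 / l\<^sup>2" for \<theta>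
  proof -
    \<comment> \<open>As \<open>v \<le> 1\<close>, the mean of \<open>\<bar>W\<bar>\<close> is at most that of \<open>\<bar>Y\<bar>\<close>; this removes \<open>\<theta>\<close> from the difference.\<close>
    have "l * (\<integral>x. normal_density \<theta> s x * \<bar>x\<bar> \<partial>lborel) \<le> l * (\<integral>x. normal_density \<theta> 1 x * \<bar>x\<bar> \<partial>lborel)"
      using normal_abs_mean_mono[OF s, of \<theta>] l by (intro mult_left_mono) auto
    moreover have "l * s * sqrt (2 / pi) \<le> l * sqrt (2 / pi)"
      using s l by (intro mult_right_mono) auto
    moreover have "ln (sqrt (2 * pi * s\<^sup>2)) = ln (sqrt (2 * pi * 1\<^sup>2)) + ln s"
      using s by (simp add: real_sqrt_mult ln_mult)
    ultimately have "prediction_risk r \<theta> p \<le> - ln s + l\<^sup>2 / 2 + l * sqrt (2 / pi)"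
      unfolding risk
      using laplace_marginal_kl_bounds(1)[OF s(1) l, of \<theta>] laplace_marginal_kl_bounds(2)[OF zero_less_one l, of \<theta>]
      by simp
    also have "\<dots> \<le> - ln s + ln (sqrt (32 * l\<^sup>2 * pi)) + l\<^sup>2 / 2 + l * sqrt (2 / pi) + 4 / l\<^sup>2"
      using log_slack_nonneg[OF l] by simp
    also have "- ln s + ln (sqrt (32 * l\<^sup>2 * pi)) = ln (sqrt (32 * l\<^sup>2 * pi / v))"
      using s l unfolding s2[symmetric] by (simp add: real_sqrt_divide ln_div)
    finally show ?thesis .
  qed
  have "(SUP \<theta>\<in>UNIV - {0}. ereal (prediction_risk r \<theta> p))
      \<le> ereal (ln (sqrt (32 * l\<^sup>2 * pi / v)) + l\<^sup>2 / 2 + l * sqrt (2 / pi) + 4 / l\<^sup>2)"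
    using nonzero by (intro SUP_least) simp
  with conv zero show ?thesis by blast
qed

end
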